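(* A compactification $K$ is soft if the space $K$ is Fréchet–Urysohn.
   Context: A compactification is a compact Hausdorff space $K$ whose set $K'$ of isolated points is dense in $K$. $\mathcal H(K,K')$ is the group of homeomorphisms $g$ of $K$ with $g(x)=x$ for all $x\in K\setminus K'$. A compactification $K$ is soft if for any disjoint sets $A,B\subseteq K'$ with $\bar A\cap\bar B\neq\emptyset$ (closures in $K$) there exists $h\in\mathcal H(K,K')$ such that the set $\{x\in A:h(x)\in B\}$ is infinite. A topological space $X$ is Fréchet–Urysohn if for any $A\subseteq X$ and $x\in\bar A\setminus A$ there exists a sequence $\{a_n\}_{n\in\omega}\subseteq A$ that converges to $x$. *)

theory Defs
  imports "HOL-Analysis.Analysis"
begin

definition isolated_points :: "'a topology \<Rightarrow> 'a set" where
  "isolated_points K = {x \<in> topspace K. openin K {x}}"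

definition compactification :: "'a topology \<Rightarrow> bool" where
  "compactification K \<longleftrightarrow>
     compact_space K \<and> Hausdorff_space K \<and>
     K closure_of (isolated_points K) = topspace K"

text \<open>
  The underlying set of the group \<open>\<H>(K, S)\<close>. Maps are taken to be extensional, so that
  each self-homeomorphism of \<open>K\<close> is represented by exactly one HOL function even when
  \<open>topspace K\<close> is not the whole type.
\<close>

definition homeomorphisms_fixing_off :: "'a topology \<Rightarrow> 'a set \<Rightarrow> ('a \<Rightarrow> 'a) set" where
  "homeomorphisms_fixing_off K S =
     {g \<in> extensional (topspace K).
        homeomorphic_map K K g \<and> (\<forall>x \<in> topspace K - S. g x = x)}"

definition soft :: "'a topology \<Rightarrow> bool" where
  "soft K \<longleftrightarrow>
     (\<forall>A B. A \<subseteq> isolated_points K \<and> B \<subseteq> isolated_points K \<and> A \<inter> B = {} \<and>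
        K closure_of A \<inter> K closure_of B \<noteq> {} \<longrightarrow>
        (\<exists>h \<in> homeomorphisms_fixing_off K (isolated_points K). infinite {x \<in> A. h x \<in> B}))"

definition Frechet_Urysohn_space :: "'a topology \<Rightarrow> bool" where
  "Frechet_Urysohn_space X \<longleftrightarrow>
     (\<forall>A x. A \<subseteq> topspace X \<and> x \<in> X closure_of A - A \<longrightarrow>
        (\<exists>a :: nat \<Rightarrow> 'a. range a \<subseteq> A \<and> limitin X a x sequentially))"

end

theory Submission
  imports Defs
begin

text \<open>
  A common point \<open>x\<close> of the closures of the disjoint sets \<open>A\<close>, \<open>B\<close> of isolated points is not
  itself isolated, so the Frechet--Urysohn property gives a sequence in \<open>A\<close> and a
  sequence in \<open>B\<close>, both tending to \<open>x\<close>. Their ranges \<open>P\<close> and \<open>Q\<close> are countably infinite, and \<open>P \<union> Q\<close>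
  converges to \<open>x\<close> as a set: each neighbourhood of \<open>x\<close> misses only finitely many of its points
  (lemma \<open>converging_sequence_in_closure\<close>). Swapping \<open>P\<close> with \<open>Q\<close> along any bijection
  and fixing everything else is a homeomorphism, because an arbitrary permutation of a
  set of isolated points that converges to \<open>x\<close> is continuous (lemma
  \<open>continuous_map_permutation_of_converging_set\<close>): injectivity forces only finitely many points
  to be thrown out of a given neighbourhood of \<open>x\<close>, and away from \<open>x\<close> only finitely many points
  move at all. This homeomorphism carries the infinite set \<open>P \<subseteq> A\<close> into \<open>B\<close>.
\<close>

text \<open>
  Convergence of sets rather than of sequences, so that neither the order of the points nor
  repetitions matter when they are permuted.
\<close>

definition converges_to :: "'a topology \<Rightarrow> 'a set \<Rightarrow> 'a \<Rightarrow> bool" where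
  "converges_to K S x \<longleftrightarrow> (\<forall>U. openin K U \<and> x \<in> U \<longrightarrow> finite (S - U))"

lemma converges_to_Un:
  "converges_to K S x \<Longrightarrow> converges_to K T x \<Longrightarrow> converges_to K (S \<union> T) x"
  by (simp add: converges_to_def Un_Diff)

lemma converging_sequence_in_closure:
  assumes FU: "Frechet_Urysohn_space K" and t1: "t1_space K"
    and A: "A \<subseteq> topspace K" and x: "x \<in> K closure_of A - A"
  obtains P where "P \<subseteq> A" "countable P" "infinite P" "converges_to K P x"
proof -
  obtain a :: "nat \<Rightarrow> 'a" where a: "range a \<subseteq> A" and lim: "limitin K a x sequentially"
    using FU A x unfolding Frechet_Urysohn_space_def by blast
  have "infinite (range a)"
  proof
    \<comment> \<open>Otherwise the complement of the range would be a neighbourhood of \<open>x\<close> that the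
      sequence never enters.\<close>
    assume "finite (range a)"
    then have "openin K (topspace K - range a)"
      using t1 a A unfolding t1_space_closedin_finite by blast
    moreover have "x \<in> topspace K - range a"
      using a x lim limitin_topspace by fastforce
    ultimately have "\<forall>\<^sub>F n in sequentially. a n \<in> topspace K - range a"
      using lim unfolding limitin_def by blast
    then show False by simp
  qed
  moreover have "converges_to K (range a) x"
    unfolding converges_to_def
  proof (intro allI impI)
    fix U assume "openin K U \<and> x \<in> U"
    then obtain N where N: "\<And>n. n \<ge> N \<Longrightarrow> a n \<in> U"
      using lim unfolding limitin_sequentially by blast
    have "range a - U \<subseteq> a ` {..<N}"
      using N not_le by auto
    then show "finite (range a - U)"
      using finite_subset by blast
  qed
  ultimately show thesis
    using that a by blast
qed

text \<open>
  At points of \<open>S\<close>, being isolated, continuity is automatic; any other point is fixed by \<open>h\<close>,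
  and it suffices to find a neighbourhood of it in which only finitely many points leave the
  target set, since those can be removed.
\<close>

lemma continuous_map_permutation_of_converging_set:
  assumes Haus: "Hausdorff_space K" and S: "S \<subseteq> isolated_points K"
    and conv: "converges_to K S x" and x: "x \<in> topspace K" and h: "h permutes S"
  shows "continuous_map K K h"
  unfolding continuous_map_def
proof (intro conjI allI impI)
  have Stop: "S \<subseteq> topspace K"
    using S by (auto simp: isolated_points_def)
  have fixed: "h w = w" if "w \<notin> S" for w
    using h that by (rule permutes_not_in)
  have hS: "h w \<in> S \<longleftrightarrow> w \<in> S" for w
    using h by (rule permutes_in_image)
  show "h \<in> topspace K \<rightarrow> topspace K"
    using Stop fixed hS by (metis Pi_I subset_iff)
  fix U assume U: "openin K U"
  show "openin K {z \<in> topspace K. h z \<in> U}"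
  proof (subst openin_subopen, intro ballI)
    fix z assume "z \<in> {z \<in> topspace K. h z \<in> U}"
    then have z: "z \<in> topspace K" "h z \<in> U" by auto
    show "\<exists>T. openin K T \<and> z \<in> T \<and> T \<subseteq> {z \<in> topspace K. h z \<in> U}"
    proof (cases "z \<in> S")
      case True
      then have "openin K {z}"
        using S by (auto simp: isolated_points_def)
      then show ?thesis
        using z by blast
    next
      case False
      then have zU: "z \<in> U"
        using z fixed by simp
      obtain V where V: "openin K V" "z \<in> V" and fin: "finite {w \<in> S \<inter> V. h w \<notin> U}"
      proof (cases "z = x")
        case True
        have "finite (S - U)"
          using conv U zU True unfolding converges_to_def by blast
        then have "finite (h -` (S - U))"
          using permutes_inj[OF h] by (rule finite_vimageI)
        moreover have "{w \<in> S \<inter> U. h w \<notin> U} \<subseteq> h -` (S - U)"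
          using hS by auto
        ultimately show thesis
          using that U zU finite_subset by blast
      next
        case False
        then obtain V W where VW: "openin K V" "openin K W" "z \<in> V" "x \<in> W" "disjnt V W"
          using Haus z x unfolding Hausdorff_space_def by metis
        have "finite (S - W)"
          using conv VW unfolding converges_to_def by blast
        moreover have "{w \<in> S \<inter> V. h w \<notin> U} \<subseteq> S - W"
          using VW by (auto simp: disjnt_iff)
        ultimately show thesis
          using that VW finite_subset by blast
      qed
      let ?F = "{w \<in> S \<inter> V. h w \<notin> U}"
      have "closedin K ?F"
        using Haus fin Stop by (intro closedin_Hausdorff_finite) auto
      then have "openin K (U \<inter> V - ?F)"
        using U V by blast
      moreover have "z \<in> U \<inter> V - ?F"
        using zU V False by blast
      moreover have "U \<inter> V - ?F \<subseteq> {z \<in> topspace K. h z \<in> U}"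
        using fixed openin_subset[OF U] by force
      ultimately show ?thesis
        by blast
    qed
  qed
qed

lemma homeomorphic_map_permutation_of_converging_set:
  assumes "Hausdorff_space K" "S \<subseteq> isolated_points K"
    and "converges_to K S x" "x \<in> topspace K" and h: "h permutes S"
  shows "homeomorphic_map K K h"
proof -
  have "homeomorphic_maps K K h (inv h)"
    unfolding homeomorphic_maps_def
    using continuous_map_permutation_of_converging_set[OF assms]
      continuous_map_permutation_of_converging_set[OF assms(1-4) permutes_inv[OF h]]
      permutes_inverses[OF h] by simp
  then show ?thesis
    by (rule homeomorphic_maps_imp_map)
qed

lemma permutation_exchanging_countable_sets:
  assumes P: "countable P" "infinite P" and Q: "countable Q" "infinite Q"
    and disj: "P \<inter> Q = {}"
  obtains h where "h permutes P \<union> Q" "h ` P = Q"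
proof -
  obtain f where f: "bij_betw f P Q"
    using bij_betw_trans[OF to_nat_on_infinite[OF P] bij_betw_from_nat_into[OF Q]] by blast
  define h where
    "h = (\<lambda>w. if w \<in> P then f w else if w \<in> Q then inv_into P f w else w)"
  have PQ: "bij_betw h P Q"
    using f by (rule bij_betw_cong[THEN iffD1, rotated]) (simp add: h_def)
  have QP: "bij_betw h Q P"
    using bij_betw_inv_into[OF f] disj
    by (subst bij_betw_cong[of _ _ "inv_into P f"]) (auto simp: h_def)
  have "bij_betw h (P \<union> Q) (Q \<union> P)"
    using PQ QP disj by (intro bij_betw_combine) auto
  then have "h permutes P \<union> Q"
    by (intro bij_imp_permutes) (auto simp: h_def Un_commute)
  then show thesis
    using that PQ by (auto simp: bij_betw_def)
qed

theorem corollary7p5: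
  fixes K :: "'a topology"
  assumes "compactification K"
    and "Frechet_Urysohn_space K"
  shows "soft K"
  unfolding soft_def
proof (intro allI impI, elim conjE)
  fix A B
  assume A: "A \<subseteq> isolated_points K" and B: "B \<subseteq> isolated_points K"
    and disj: "A \<inter> B = {}" and "K closure_of A \<inter> K closure_of B \<noteq> {}"
  then obtain x where x: "x \<in> K closure_of A" "x \<in> K closure_of B" by blast
  have Haus: "Hausdorff_space K"
    using assms(1) by (simp add: compactification_def)
  then have t1: "t1_space K"
    by (rule Hausdorff_imp_t1_space)
  have top: "A \<subseteq> topspace K" "B \<subseteq> topspace K" "x \<in> topspace K"
    using A B x(1) by (auto simp: isolated_points_def in_closure_of)
  \<comment> \<open>If \<open>x\<close> were isolated, its open singleton would meet both sets, so \<open>x\<close> would lie in both sets.\<close>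
  have "\<not> openin K {x}"
    using x disj unfolding in_closure_of by blast
  then have "x \<notin> A" "x \<notin> B"
    using A B by (auto simp: isolated_points_def)
  then have xAB: "x \<in> K closure_of A - A" "x \<in> K closure_of B - B"
    using x by auto
  obtain P where P: "P \<subseteq> A" "countable P" "infinite P" "converges_to K P x"
    using converging_sequence_in_closure[OF assms(2) t1 top(1) xAB(1)] .
  obtain Q where Q: "Q \<subseteq> B" "countable Q" "infinite Q" "converges_to K Q x"
    using converging_sequence_in_closure[OF assms(2) t1 top(2) xAB(2)] .
  obtain h where h: "h permutes P \<union> Q" "h ` P = Q"
    using permutation_exchanging_countable_sets[OF P(2,3) Q(2,3)] P(1) Q(1) disj by blast
  have PQ: "P \<union> Q \<subseteq> isolated_points K"
    using P Q A B by blast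
  have "homeomorphic_map K K h"
    using homeomorphic_map_permutation_of_converging_set
      [OF Haus PQ converges_to_Un[OF P(4) Q(4)] top(3) h(1)] .
  then have "homeomorphic_map K K (restrict h (topspace K))"
    by (rule homeomorphic_map_eq) simp
  moreover have "h z = z" if "z \<notin> isolated_points K" for z
    using h(1) PQ that by (meson permutes_not_in subsetD)
  ultimately have
    "restrict h (topspace K) \<in> homeomorphisms_fixing_off K (isolated_points K)"
    by (simp add: homeomorphisms_fixing_off_def)
  moreover have "P \<subseteq> {z \<in> A. restrict h (topspace K) z \<in> B}"
    using P(1) Q(1) h(2) top(1) by auto
  then have "infinite {z \<in> A. restrict h (topspace K) z \<in> B}"
    using P(3) infinite_super by blast
  ultimately show "\<exists>h\<in>homeomorphisms_fixing_off K (isolated_points K). infinite {x \<in> A. h x \<in> B}"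
    by blast
qed

end
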